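(* Let $Q\in\mathbb{R}^{n\times n}$ be symmetric with $\lambda_Q<0$ and let $g\in\mathbb{R}^n$. Then a tight convex relaxation of the classical trust-region subproblem $$\mathrm{Opt}_h=\min_{y\in\mathbb{R}^n}\{h(y):=y^\top Qy+2g^\top y:\ \|y\|\le 1\}$$ is given by $$\mathrm{Opt}_f=\min_{y\in\mathbb{R}^n}\{f(y):=y^\top(Q-\lambda_Q I_n)y+2g^\top y+\lambda_Q:\ \|y\|\le 1\},$$ i.e. the latter is a convex problem, $f\le h$ on the unit ball, and $\mathrm{Opt}_f=\mathrm{Opt}_h$.
   Context: $\|\cdot\|$ is the Euclidean norm and $\lambda_Q:=\lambda_{\min}(Q)$ is the minimum eigenvalue of $Q$. *)

theory Defs
  imports "HOL-Analysis.Analysis"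
begin

definition eigenvalue :: "real ^ 'n ^ 'n \<Rightarrow> real \<Rightarrow> bool" where
  "eigenvalue A l \<longleftrightarrow> (\<exists>v. v \<noteq> 0 \<and> A *v v = l *\<^sub>R v)"

(* Meaningful for symmetric A, whose set of real eigenvalues is finite and nonempty. *)
definition lambda_min :: "real ^ 'n ^ 'n \<Rightarrow> real" where
  "lambda_min A = Min {l. eigenvalue A l}"

definition trs_objective :: "real ^ 'n ^ 'n \<Rightarrow> real ^ 'n \<Rightarrow> real ^ 'n \<Rightarrow> real" where
  "trs_objective Q g y = y \<bullet> (Q *v y) + 2 * (g \<bullet> y)"

definition trs_relaxed_objective :: "real ^ 'n ^ 'n \<Rightarrow> real ^ 'n \<Rightarrow> real ^ 'n \<Rightarrow> real" where
  "trs_relaxed_objective Q g y =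
     y \<bullet> ((Q - lambda_min Q *\<^sub>R mat 1) *v y) + 2 * (g \<bullet> y) + lambda_min Q"

definition attains_min_on :: "'a set \<Rightarrow> ('a \<Rightarrow> real) \<Rightarrow> bool" where
  "attains_min_on S f \<longleftrightarrow> (\<exists>x\<in>S. \<forall>y\<in>S. f x \<le> f y)"

(* This is the minimum value of f on S whenever attains_min_on S f holds. *)
definition opt_value :: "'a set \<Rightarrow> ('a \<Rightarrow> real) \<Rightarrow> real" where
  "opt_value S f = (INF y\<in>S. f y)"

definition convex_problem :: "'a::real_vector set \<Rightarrow> ('a \<Rightarrow> real) \<Rightarrow> bool" where
  "convex_problem S f \<longleftrightarrow> convex S \<and> convex_on UNIV f"

end

theory Submission
  imports Defs
begin

text \<open>
  Minimising the Rayleigh quotient gives \<open>v \<bullet> (Q *v v) = \<lambda>\<^sub>Q\<close> for a unit vector \<open>v\<close>, which is then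
  in the kernel of the positive semidefinite matrix \<open>Q - \<lambda>\<^sub>Q I\<close>.
  Hence \<open>f\<close> is convex, and it is affine along \<open>v\<close>: from a minimiser of \<open>f\<close> in the ball one moves
  along \<open>v\<close> or \<open>-v\<close>, without increasing \<open>f\<close>, until the unit sphere is reached.
  There \<open>f\<close> and \<open>h\<close> agree, as \<open>f y - h y = \<lambda>\<^sub>Q (1 - \<parallel>y\<parallel>\<^sup>2)\<close>; this is also why \<open>f \<le> h\<close> on the ball.
\<close>

lemma symmetric_inner_matrix_vector:
  fixes A :: "real ^ 'n ^ 'n"
  assumes "transpose A = A"
  shows "x \<bullet> (A *v y) = (A *v x) \<bullet> y"
  using dot_lmul_matrix[of x A y] assms by (metis transpose_matrix_vector)

lemma shifted_matrix_vector_mult: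
  fixes A :: "real ^ 'n ^ 'n"
  shows "(A - l *\<^sub>R mat 1) *v x = A *v x - l *\<^sub>R x"
  by (simp add: matrix_vector_mult_diff_rdistrib scaleR_matrix_vector_assoc[symmetric])

lemma symmetric_shifted:
  fixes A :: "real ^ 'n ^ 'n"
  assumes "transpose A = A"
  shows "transpose (A - l *\<^sub>R mat 1) = A - l *\<^sub>R mat 1"
  using assms by (auto simp: transpose_def vec_eq_iff mat_def)

lemma quadratic_form_add:
  fixes A :: "real ^ 'n ^ 'n"
  assumes "transpose A = A"
  shows "(x + t *\<^sub>R y) \<bullet> (A *v (x + t *\<^sub>R y))
    = x \<bullet> (A *v x) + 2 * t * (y \<bullet> (A *v x)) + t\<^sup>2 * (y \<bullet> (A *v y))"
  using symmetric_inner_matrix_vector[OF assms, of x y]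
  by (simp add: matrix_vector_right_distrib matrix_vector_mult_scaleR inner_add_left
      inner_add_right inner_commute power2_eq_square algebra_simps)

text \<open>With \<open>w = A *v v\<close>, moving from \<open>v\<close> to
  \<open>v + t *\<^sub>R w\<close> changes the form by \<open>2 * t * (w \<bullet> w)\<close> to
  first order, so a small negative \<open>t\<close> would make it negative unless
  \<open>w = 0\<close>.\<close>

lemma psd_kernel:
  fixes A :: "real ^ 'n ^ 'n"
  assumes sym: "transpose A = A" and psd: "\<And>x. 0 \<le> x \<bullet> (A *v x)"
    and v: "v \<bullet> (A *v v) = 0"
  shows "A *v v = 0"
proof -
  define w where "w = A *v v"
  define c where "c = w \<bullet> (A *v w)"
  have c: "c \<ge> 0" unfolding c_def by (rule psd)
  \<comment> \<open>The minimiser of the quadratic in \<open>t\<close> would be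
    \<open>- (w \<bullet> w) / c\<close>; the denominator \<open>c + 1\<close> also covers
    \<open>c = 0\<close>, and the quadratic then equals
    \<open>- t\<^sup>2 * (c + 2)\<close>.\<close>
  define t where "t = - (w \<bullet> w) / (c + 1)"
  have "0 \<le> (v + t *\<^sub>R w) \<bullet> (A *v (v + t *\<^sub>R w))" by (rule psd)
  also have "\<dots> = 2 * t * (w \<bullet> w) + t\<^sup>2 * c"
    using quadratic_form_add[OF sym, of v t w] v by (simp add: w_def c_def)
  finally have *: "0 \<le> 2 * t * (w \<bullet> w) + t\<^sup>2 * c" .
  have "t * (c + 1) = - (w \<bullet> w)"
    using c by (simp add: t_def)
  then have "2 * t * (w \<bullet> w) + t\<^sup>2 * c = - t\<^sup>2 * (c + 2)"
    by algebra
  with * have "t\<^sup>2 * (c + 2) \<le> 0" by simp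
  with c have "t = 0"
    by (simp add: mult_le_0_iff)
  with c show ?thesis by (simp add: t_def w_def)
qed

lemma convex_on_quadratic_form:
  fixes A :: "real ^ 'n ^ 'n"
  assumes sym: "transpose A = A" and psd: "\<And>x. 0 \<le> x \<bullet> (A *v x)"
  shows "convex_on UNIV (\<lambda>x. x \<bullet> (A *v x))"
proof (rule convex_onI)
  fix t :: real and x y :: "real ^ 'n"
  assume t: "0 < t" "t < 1"
  have eq: "(1 - t) *\<^sub>R x + t *\<^sub>R y = x + t *\<^sub>R (y - x)"
    by (simp add: algebra_simps)
  have y: "y \<bullet> (A *v y) = x \<bullet> (A *v x) + 2 * ((y - x) \<bullet> (A *v x)) + (y - x) \<bullet> (A *v (y - x))"
    using quadratic_form_add[OF sym, of x 1 "y - x"] by simp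
  \<comment> \<open>This product is exactly the gap between the two sides of the convexity
    inequality.\<close>
  have "0 \<le> t * (1 - t) * ((y - x) \<bullet> (A *v (y - x)))"
    using t psd by simp
  then show "((1 - t) *\<^sub>R x + t *\<^sub>R y) \<bullet> (A *v ((1 - t) *\<^sub>R x + t *\<^sub>R y))
    \<le> (1 - t) * (x \<bullet> (A *v x)) + t * (y \<bullet> (A *v y))"
    unfolding eq quadratic_form_add[OF sym] y by (simp add: algebra_simps power2_eq_square)
qed simp

text \<open>Eigenvectors of distinct eigenvalues are orthogonal, so choosing one per eigenvalue
  gives an injection onto an orthogonal, hence finite, set. This makes the \<open>Min\<close> in
  \<open>lambda_min\<close> meaningful.\<close>

lemma finite_eigenvalues_symmetric:
  fixes A :: "real ^ 'n ^ 'n"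
  assumes sym: "transpose A = A"
  shows "finite {l. eigenvalue A l}"
proof -
  define e where "e l = (SOME v. v \<noteq> 0 \<and> A *v v = l *\<^sub>R v)" for l
  have e: "e l \<noteq> 0" "A *v e l = l *\<^sub>R e l" if "eigenvalue A l" for l
    using someI_ex[of "\<lambda>v. v \<noteq> 0 \<and> A *v v = l *\<^sub>R v"] that
    unfolding eigenvalue_def e_def by auto
  have orth: "e l \<bullet> e m = 0" if "eigenvalue A l" "eigenvalue A m" "l \<noteq> m" for l m
    using symmetric_inner_matrix_vector[OF sym, of "e l" "e m"] e that by auto
  have inj: "inj_on e {l. eigenvalue A l}"
  proof (rule inj_onI, rule ccontr)
    fix l m
    assume "l \<in> {l. eigenvalue A l}" "m \<in> {l. eigenvalue A l}" "e l = e m" "l \<noteq> m"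
    then show False using orth[of l m] e(1)[of m] by simp
  qed
  have "pairwise orthogonal (e ` {l. eigenvalue A l})"
    using orth by (auto simp: pairwise_def orthogonal_def)
  then have "finite (e ` {l. eigenvalue A l})"
    by (rule pairwise_orthogonal_imp_finite)
  then show ?thesis
    using inj finite_imageD by blast
qed

lemma attains_min_on_compact:
  assumes "compact S" "S \<noteq> {}" "continuous_on S f"
  shows "attains_min_on S f"
  using continuous_attains_inf[OF assms] by (simp add: attains_min_on_def)

lemma lambda_min_symmetric:
  fixes A :: "real ^ 'n ^ 'n"
  assumes sym: "transpose A = A"
  obtains v where "norm v = 1" "A *v v = lambda_min A *\<^sub>R v"
    "\<And>x. lambda_min A * (norm x)\<^sup>2 \<le> x \<bullet> (A *v x)"
proof -
  have "attains_min_on (sphere 0 1) (\<lambda>x. x \<bullet> (A *v x))"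
    by (intro attains_min_on_compact continuous_intros linear_continuous_on
        matrix_vector_mul_bounded_linear) auto
  then obtain v where v: "v \<in> sphere 0 1"
    and min: "\<And>x. x \<in> sphere 0 1 \<Longrightarrow> v \<bullet> (A *v v) \<le> x \<bullet> (A *v x)"
    by (auto simp: attains_min_on_def)
  define m where "m = v \<bullet> (A *v v)"
  have nv: "norm v = 1" using v by simp
  have ray: "m * (norm x)\<^sup>2 \<le> x \<bullet> (A *v x)" for x
  proof (cases "x = 0")
    case False
    \<comment> \<open>The form is homogeneous of degree 2, so the bound on the sphere extends to
      \<open>x\<close> through its normalisation \<open>sgn x\<close>.\<close>
    have "m \<le> sgn x \<bullet> (A *v sgn x)"
      unfolding m_def using min[of "sgn x"] False by (simp add: norm_sgn)
    also have "\<dots> = x \<bullet> (A *v x) / (norm x)\<^sup>2"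
      by (simp add: sgn_div_norm matrix_vector_mult_scaleR power2_eq_square field_simps)
    finally show ?thesis using False by (simp add: field_simps)
  qed simp
  define B where "B = A - m *\<^sub>R mat 1"
  have "0 \<le> x \<bullet> (B *v x)" for x
    using ray[of x]
    by (simp add: B_def shifted_matrix_vector_mult inner_diff_right power2_norm_eq_inner)
  moreover have "v \<bullet> (B *v v) = 0"
    using nv by (simp add: B_def shifted_matrix_vector_mult inner_diff_right m_def
        power2_norm_eq_inner[symmetric])
  ultimately have "B *v v = 0"
    using psd_kernel symmetric_shifted[OF sym] unfolding B_def by blast
  then have Av: "A *v v = m *\<^sub>R v"
    by (simp add: B_def shifted_matrix_vector_mult)
  \<comment> \<open>\<open>ray\<close> at an eigenvector bounds its eigenvalue below by
    \<open>m\<close>, and \<open>v\<close> shows that \<open>m\<close> is itself an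
    eigenvalue.\<close>
  have "lambda_min A = m"
    unfolding lambda_min_def
  proof (rule Min_eqI[OF finite_eigenvalues_symmetric[OF sym]])
    fix l assume "l \<in> {l. eigenvalue A l}"
    then obtain x where "x \<noteq> 0" "A *v x = l *\<^sub>R x" by (auto simp: eigenvalue_def)
    then show "m \<le> l" using ray[of x] by (simp add: power2_norm_eq_inner)
  next
    have "v \<noteq> 0" using nv by auto
    then show "m \<in> {l. eigenvalue A l}" using Av by (auto simp: eigenvalue_def)
  qed
  then show ?thesis using that nv Av ray by blast
qed

lemma opt_value_eqI:
  assumes "x \<in> S" "\<And>y. y \<in> S \<Longrightarrow> f x \<le> f y"
  shows "opt_value S f = f x"
  unfolding opt_value_def using assms by (intro cInf_eq_minimum) auto

theorem theorem5:
  fixes Q :: "real ^ 'n ^ 'n" and g :: "real ^ 'n"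
  assumes "transpose Q = Q"
    and "lambda_min Q < 0"
  shows "attains_min_on (cball 0 1) (trs_objective Q g)
    \<and> attains_min_on (cball 0 1) (trs_relaxed_objective Q g)
    \<and> convex_problem (cball 0 1) (trs_relaxed_objective Q g)
    \<and> (\<forall>y\<in>cball 0 1. trs_relaxed_objective Q g y \<le> trs_objective Q g y)
    \<and> opt_value (cball 0 1) (trs_relaxed_objective Q g)
        = opt_value (cball 0 1) (trs_objective Q g)"
proof -
  let ?f = "trs_relaxed_objective Q g" and ?h = "trs_objective Q g"
  define l where "l = lambda_min Q"
  define B where "B = Q - l *\<^sub>R mat 1"
  obtain v where v: "norm v = 1" "Q *v v = l *\<^sub>R v"
    and ray: "\<And>x. l * (norm x)\<^sup>2 \<le> x \<bullet> (Q *v x)"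
    using lambda_min_symmetric[OF assms(1)] unfolding l_def by blast
  have B: "B *v x = Q *v x - l *\<^sub>R x" for x
    by (simp add: B_def shifted_matrix_vector_mult)
  have symB: "transpose B = B"
    unfolding B_def by (rule symmetric_shifted[OF assms(1)])
  have psdB: "0 \<le> x \<bullet> (B *v x)" for x
    using ray[of x] by (simp add: B inner_diff_right power2_norm_eq_inner)
  have f: "?f = (\<lambda>y. y \<bullet> (B *v y) + 2 * (g \<bullet> y) + l)"
    by (simp add: trs_relaxed_objective_def B_def l_def fun_eq_iff)
  have fh: "?f y = ?h y + l * (1 - (norm y)\<^sup>2)" for y
    by (simp add: f trs_objective_def B inner_diff_right power2_norm_eq_inner algebra_simps)
  have le: "?f y \<le> ?h y" if "y \<in> cball 0 1" for y
  proof -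
    have "(norm y)\<^sup>2 \<le> 1" using that by (simp add: power_le_one)
    then show ?thesis using assms(2) by (simp add: fh l_def mult_nonpos_nonneg)
  qed
  have min_h: "attains_min_on (cball 0 1) ?h"
    unfolding trs_objective_def
    by (intro attains_min_on_compact continuous_intros linear_continuous_on
        matrix_vector_mul_bounded_linear) auto
  have min_f: "attains_min_on (cball 0 1) ?f"
    unfolding f
    by (intro attains_min_on_compact continuous_intros linear_continuous_on
        matrix_vector_mul_bounded_linear) auto
  have "convex_on UNIV (\<lambda>y. 2 * (g \<bullet> y))"
    by (rule convex_onI) (simp_all add: inner_add_right algebra_simps)
  then have conv: "convex_problem (cball 0 1) ?f"
    unfolding convex_problem_def f
    by (intro conjI convex_cball convex_on_add convex_on_const[THEN iffD2] convex_on_quadratic_form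
        symB psdB) auto
  obtain x where x: "norm x \<le> 1" and xmin: "\<And>y. y \<in> cball 0 1 \<Longrightarrow> ?f x \<le> ?f y"
    using min_f unfolding attains_min_on_def by auto
  \<comment> \<open>The kernel of \<open>B\<close> contains both \<open>v\<close> and
    \<open>- v\<close>; the sign is chosen so that the linear term does not increase along
    \<open>u\<close>.\<close>
  define u where "u = (if g \<bullet> v \<le> 0 then v else - v)"
  have u: "norm u = 1" "B *v u = 0" "g \<bullet> u \<le> 0"
    using v matrix_vector_mult_scaleR[of Q "- 1" v] by (auto simp: u_def B)
  \<comment> \<open>Since \<open>norm x \<le> 1\<close>, the point at \<open>t = 2\<close> has norm
    at least 1, while the point at \<open>t = 0\<close> has norm at most 1; the intermediate value
    theorem gives a crossing of the sphere.\<close>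
  have "2 \<le> norm (x + 2 *\<^sub>R u) + norm x"
    using norm_triangle_ineq4[of "x + 2 *\<^sub>R u" x] u(1) by simp
  then obtain t where t: "0 \<le> t" "norm (x + t *\<^sub>R u) = 1"
    using IVT'[of "\<lambda>t. norm (x + t *\<^sub>R u)" 0 1 2] x by (force intro!: continuous_intros)
  define z where "z = x + t *\<^sub>R u"
  have z: "z \<in> cball 0 1" "norm z = 1" using t by (auto simp: z_def)
  \<comment> \<open>By symmetry the cross term of the expansion vanishes too, leaving only the slope
    \<open>2 * (g \<bullet> u)\<close>.\<close>
  have "u \<bullet> (B *v x) = 0"
    using symmetric_inner_matrix_vector[OF symB, of u x] u(2) by simp
  then have "?f z = ?f x + 2 * t * (g \<bullet> u)"
    unfolding f z_def quadratic_form_add[OF symB] using u(2) by (simp add: inner_add_right)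
  also have "\<dots> \<le> ?f x"
    using t(1) u(3) by (simp add: mult_nonneg_nonpos)
  finally have zmin: "?f z \<le> ?f y" if "y \<in> cball 0 1" for y
    using xmin[OF that] by simp
  have hz: "?h z = ?f z"
    using z(2) by (simp add: fh)
  \<comment> \<open>The chain \<open>?h z = ?f z \<le> ?f y \<le> ?h y\<close> shows that
    \<open>z\<close> minimises both objectives.\<close>
  have "?h z \<le> ?h y" if "y \<in> cball 0 1" for y
    using zmin[OF that] le[OF that] hz by simp
  then have "opt_value (cball 0 1) ?h = ?h z"
    using z(1) by (intro opt_value_eqI)
  moreover have "opt_value (cball 0 1) ?f = ?f z"
    using z(1) zmin by (intro opt_value_eqI)
  ultimately show ?thesis
    using min_h min_f conv le hz by simp
qed

end
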